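(* Let $\mathbb{X}=(X,\langle\cdot,\cdot\rangle,\xi)$ be a gm-space with $X\subset\mathbb{R}^d$, gauge the Euclidean scalar product, and $\xi$ absolutely continuous with respect to Lebesgue measure on $\mathbb{R}^d$. If $\int_X\|x\|^{2+\delta}\,\mathrm{d}\xi(x)<\infty$ for some $\delta>0$, then $\mathrm{q}_n^{\mathrm{GW}}(\mathbb{X})\asymp n^{-1/d}$, that is, $$\limsup_{n\to\infty}n^{1/d}\,\mathrm{q}_n^{\mathrm{GW}}(\mathbb{X})<\infty\qquad\text{and}\qquad\liminf_{n\to\infty}n^{1/d}\,\mathrm{q}_n^{\mathrm{GW}}(\mathbb{X})>0.$$
   Context: A gauged measure space (gm-space) is a triple $(X,g,\xi)$ where $X$ is a Polish space, $\xi$ is a Borel probability measure on $X$, and the gauge $g\in L^2(X\times X,\xi\otimes\xi)$ is symmetric. For gm-spaces $\mathbb{X}=(X,g,\xi)$ and $\mathbb{Y}=(Y,h,\upsilon)$, with $\Pi(\xi,\upsilon)$ the set of couplings of $\xi$ and $\upsilon$, $$\mathrm{GW}_2(\mathbb{X},\mathbb{Y})=\inf_{\pi\in\Pi(\xi,\upsilon)}\Big(\iint_{(X\times Y)^2}|g(x,x')-h(y,y')|^2\,\mathrm{d}\pi(x,y)\,\mathrm{d}\pi(x',y')\Big)^{1/2}.$$ Write $[n]=\{1,\dots,n\}$. $\mathfrak{GM}_n$ is the set of gm-spaces $([n],G,\upsilon)$ with $G\in\mathbb{R}^{n\times n}$ symmetric (viewed as the gauge $(i,i')\mapsto G_{i,i'}$)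 and $\upsilon$ a probability measure on $[n]$; $\mathrm{q}_n^{\mathrm{GW}}(\mathbb{X}):=\inf_{\mathbb{Y}\in\mathfrak{GM}_n}\mathrm{GW}_2(\mathbb{X},\mathbb{Y})$. *)

theory Defs
  imports "HOL-Analysis.Analysis" "HOL-Probability.Probability_Measure"
begin

definition polish :: "'a topology \<Rightarrow> bool" where
  "polish T \<longleftrightarrow> completely_metrizable_space T \<and> separable_space T"

definition borel_sigma :: "'a topology \<Rightarrow> 'a measure" where
  "borel_sigma T = sigma (topspace T) {U. openin T U}"

text \<open>A triple of a topology (whose \<open>topspace\<close> is the underlying set), a gauge and a measure.
  The gauge is a representative of a class in \<open>L\<^sup>2\<close>, so its symmetry is required almost everywhere,
  and its values off the underlying set are irrelevant.\<close>

type_synonym 'a gauged = "'a topology \<times> ('a \<Rightarrow> 'a \<Rightarrow> real) \<times> 'a measure"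

definition gm_space :: "'a gauged \<Rightarrow> bool" where
  "gm_space = (\<lambda>(T, g, \<xi>).
     polish T \<and>
     prob_space \<xi> \<and> space \<xi> = topspace T \<and> sets \<xi> = sets (borel_sigma T) \<and>
     (\<lambda>(x, x'). g x x') \<in> borel_measurable (\<xi> \<Otimes>\<^sub>M \<xi>) \<and>
     integrable (\<xi> \<Otimes>\<^sub>M \<xi>) (\<lambda>(x, x'). (g x x')\<^sup>2) \<and>
     (AE (x, x') in \<xi> \<Otimes>\<^sub>M \<xi>. g x x' = g x' x))"

definition couplings :: "'a measure \<Rightarrow> 'b measure \<Rightarrow> ('a \<times> 'b) measure set" where
  "couplings \<xi> \<upsilon> = {\<pi>. prob_space \<pi> \<and> sets \<pi> = sets (\<xi> \<Otimes>\<^sub>M \<upsilon>) \<and>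
                        distr \<pi> \<xi> fst = \<xi> \<and> distr \<pi> \<upsilon> snd = \<upsilon>}"

text \<open>For gm-spaces the integrand below is integrable for every coupling
  (\<open>GW_integrable\<close>), so the convention that a Bochner integral is 0 for
  non-integrable functions plays no role; nor does the value of \<open>Inf {}\<close>, since
  \<open>couplings\<close> contains the product measure.\<close>

definition GW2 :: "'a gauged \<Rightarrow> 'b gauged \<Rightarrow> real" where
  "GW2 = (\<lambda>(T, g, \<xi>) (S, h, \<upsilon>).
     INF \<pi>\<in>couplings \<xi> \<upsilon>.
       sqrt (\<integral>((x, y), (x', y')). \<bar>g x x' - h y y'\<bar>\<^sup>2 \<partial>(\<pi> \<Otimes>\<^sub>M \<pi>)))"

definition GM :: "nat \<Rightarrow> nat gauged set" where
  "GM n = {(discrete_topology {1..n}, G, \<upsilon>) | G \<upsilon>.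
     (\<forall>i\<in>{1..n}. \<forall>j\<in>{1..n}. G i j = G j i) \<and>
     prob_space \<upsilon> \<and> space \<upsilon> = {1..n} \<and> sets \<upsilon> = Pow {1..n}}"

text \<open>\<open>GM 0\<close> is empty, so this is meaningful only for \<open>n \<ge> 1\<close>.\<close>

definition q_GW :: "nat \<Rightarrow> 'a gauged \<Rightarrow> real" where
  "q_GW n \<X> = (INF \<Y>\<in>GM n. GW2 \<X> \<Y>)"

lemma GM_gm_space:
  assumes "\<Y> \<in> GM n"
  shows "gm_space \<Y>"
proof -
  obtain G \<upsilon> where Y: "\<Y> = (discrete_topology {1..n}, G, \<upsilon>)"
    and sym: "\<forall>i\<in>{1..n}. \<forall>j\<in>{1..n}. G i j = G j i"
    and P: "prob_space \<upsilon>" and sp: "space \<upsilon> = {1..n}" and se: "sets \<upsilon> = Pow {1..n}"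
    using assms by (auto simp: GM_def)
  interpret prob_space \<upsilon> by (rule P)
  interpret PP: pair_prob_space \<upsilon> \<upsilon> ..
  have cs: "sets \<upsilon> = sets (count_space {1..n})" by (simp add: se)
  have "sets (\<upsilon> \<Otimes>\<^sub>M \<upsilon>) = sets (count_space {1..n} \<Otimes>\<^sub>M count_space {1..n})"
    by (intro sets_pair_measure_cong cs)
  also have "\<dots> = sets (count_space ({1..n} \<times> {1..n}))"
    by (subst pair_measure_count_space) auto
  finally have s2: "sets (\<upsilon> \<Otimes>\<^sub>M \<upsilon>) = sets (count_space ({1..n} \<times> {1..n}))" .
  have meas: "f \<in> borel_measurable (\<upsilon> \<Otimes>\<^sub>M \<upsilon>)" for f :: "nat \<times> nat \<Rightarrow> real"
    by (subst measurable_cong_sets[OF s2 refl]) simp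
  have sp2: "space (\<upsilon> \<Otimes>\<^sub>M \<upsilon>) = {1..n} \<times> {1..n}" by (simp add: space_pair_measure sp)
  have int: "integrable (\<upsilon> \<Otimes>\<^sub>M \<upsilon>) f" for f :: "nat \<times> nat \<Rightarrow> real"
  proof (rule PP.integrable_const_bound)
    show "AE x in \<upsilon> \<Otimes>\<^sub>M \<upsilon>. norm (f x) \<le> Max (insert 0 ((\<lambda>x. norm (f x)) ` ({1..n} \<times> {1..n})))"
      by (rule AE_I2) (auto simp: sp2)
  qed (rule meas)
  have ae: "AE (x, x') in \<upsilon> \<Otimes>\<^sub>M \<upsilon>. G x x' = G x' x"
    by (rule AE_I2) (use sym in \<open>auto simp: sp2\<close>)
  have pol: "polish (discrete_topology {1..n})"
    by (simp add: polish_def completely_metrizable_space_discrete_topology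
        separable_space_discrete_topology countable_finite)
  have "{U. openin (discrete_topology {1..n}) U} = Pow {1..n}" by auto
  then have "sets (borel_sigma (discrete_topology {1..n})) = Pow {1..n}"
    using sigma_algebra.sigma_sets_eq[OF sigma_algebra_Pow[of "{1..n}"]]
    by (simp add: borel_sigma_def del: openin_discrete_topology)
  then show ?thesis
    using pol by (simp add: gm_space_def Y P sp se meas int ae)
qed

lemma GW_integrable:
  assumes X: "gm_space (T, g, \<xi>)" and Y: "gm_space (S, h, \<upsilon>)" and \<pi>: "\<pi> \<in> couplings \<xi> \<upsilon>"
  shows "integrable (\<pi> \<Otimes>\<^sub>M \<pi>) (\<lambda>((x, y), (x', y')). \<bar>g x x' - h y y'\<bar>\<^sup>2)"
proof -
  have gm: "(\<lambda>(x, x'). g x x') \<in> borel_measurable (\<xi> \<Otimes>\<^sub>M \<xi>)"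
    and gi: "integrable (\<xi> \<Otimes>\<^sub>M \<xi>) (\<lambda>(x, x'). (g x x')\<^sup>2)"
    and hm: "(\<lambda>(x, x'). h x x') \<in> borel_measurable (\<upsilon> \<Otimes>\<^sub>M \<upsilon>)"
    and hi: "integrable (\<upsilon> \<Otimes>\<^sub>M \<upsilon>) (\<lambda>(x, x'). (h x x')\<^sup>2)"
    and "prob_space \<xi>" "prob_space \<upsilon>"
    using X Y by (auto simp: gm_space_def)
  have "prob_space \<pi>" and se[measurable_cong]: "sets \<pi> = sets (\<xi> \<Otimes>\<^sub>M \<upsilon>)"
    and d1: "distr \<pi> \<xi> fst = \<xi>" and d2: "distr \<pi> \<upsilon> snd = \<upsilon>"
    using \<pi> by (auto simp: couplings_def)
  interpret \<xi>: prob_space \<xi> by fact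
  interpret \<upsilon>: prob_space \<upsilon> by fact
  interpret \<pi>: prob_space \<pi> by fact
  interpret \<pi>\<pi>: pair_prob_space \<pi> \<pi> ..
  have f1[measurable]: "fst \<in> \<pi> \<rightarrow>\<^sub>M \<xi>" and f2[measurable]: "snd \<in> \<pi> \<rightarrow>\<^sub>M \<upsilon>"
    by measurable
  have D1: "\<xi> \<Otimes>\<^sub>M \<xi> = distr (\<pi> \<Otimes>\<^sub>M \<pi>) (\<xi> \<Otimes>\<^sub>M \<xi>) (\<lambda>(p, q). (fst p, fst q))"
    using pair_measure_distr[OF f1 f1] d1 by (simp add: \<xi>.sigma_finite_measure_axioms)
  have D2: "\<upsilon> \<Otimes>\<^sub>M \<upsilon> = distr (\<pi> \<Otimes>\<^sub>M \<pi>) (\<upsilon> \<Otimes>\<^sub>M \<upsilon>) (\<lambda>(p, q). (snd p, snd q))"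
    using pair_measure_distr[OF f2 f2] d2 by (simp add: \<upsilon>.sigma_finite_measure_axioms)
  have m1[measurable]: "(\<lambda>(p, q). (fst p, fst q)) \<in> \<pi> \<Otimes>\<^sub>M \<pi> \<rightarrow>\<^sub>M \<xi> \<Otimes>\<^sub>M \<xi>"
    and m2[measurable]: "(\<lambda>(p, q). (snd p, snd q)) \<in> \<pi> \<Otimes>\<^sub>M \<pi> \<rightarrow>\<^sub>M \<upsilon> \<Otimes>\<^sub>M \<upsilon>"
    by measurable
  have i1: "integrable (\<pi> \<Otimes>\<^sub>M \<pi>) (\<lambda>(p, q). (g (fst p) (fst q))\<^sup>2)"
    using gi by (subst (asm) D1, subst (asm) integrable_distr_eq)
      (use gm in \<open>auto simp: case_prod_beta'\<close>)
  have i2: "integrable (\<pi> \<Otimes>\<^sub>M \<pi>) (\<lambda>(p, q). (h (snd p) (snd q))\<^sup>2)"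
    using hi by (subst (asm) D2, subst (asm) integrable_distr_eq)
      (use hm in \<open>auto simp: case_prod_beta'\<close>)
  have g': "(\<lambda>(p, q). g (fst p) (fst q)) \<in> borel_measurable (\<pi> \<Otimes>\<^sub>M \<pi>)"
    using measurable_compose[OF m1 gm] by (simp add: case_prod_beta')
  have h': "(\<lambda>(p, q). h (snd p) (snd q)) \<in> borel_measurable (\<pi> \<Otimes>\<^sub>M \<pi>)"
    using measurable_compose[OF m2 hm] by (simp add: case_prod_beta')
  have "integrable (\<pi> \<Otimes>\<^sub>M \<pi>)
          (\<lambda>(p, q). 2 * (g (fst p) (fst q))\<^sup>2 + 2 * (h (snd p) (snd q))\<^sup>2)"
    using i1 i2 by (simp add: case_prod_beta')
  moreover have "(a - b)\<^sup>2 \<le> 2 * a\<^sup>2 + 2 * b\<^sup>2" for a b :: real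
    using zero_le_power2[of "a + b"] by (simp add: power2_eq_square algebra_simps)
  moreover have "(\<lambda>((x, y), (x', y')). \<bar>g x x' - h y y'\<bar>\<^sup>2) \<in> borel_measurable (\<pi> \<Otimes>\<^sub>M \<pi>)"
    using g' h' by (simp add: case_prod_beta')
  ultimately show ?thesis
    by (elim Bochner_Integration.integrable_bound) (auto simp: case_prod_beta')
qed

end

theory Submission
  imports Defs
begin

text \<open>The rate is that of quantising \<open>\<xi>\<close> itself in \<open>L\<^sup>2\<close> by \<open>n\<close> points, and both halves of the proof
compare the Gromov-Wasserstein cost with that quantisation error.

Upper bound. A quantiser \<open>T\<close> with at most \<open>n\<close> values gives the competitor whose points are the
values of \<open>T\<close> and whose gauge is their scalar product. Under the coupling of \<open>x\<close> with \<open>T x\<close> the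
distortion is \<open>x \<bullet> x' - T x \<bullet> T x' = x \<bullet> (x' - T x') + (x - T x) \<bullet> T x'\<close>. The moment of order
\<open>2 + \<delta>\<close> pays for a quantiser of the whole space whose error at \<open>x\<close> is at most a constant times
\<open>n powr (- 1 / d) * (1 + norm x) powr (1 + \<delta> / 2)\<close>. It is built one coordinate at a time: the
line is mapped into a bounded interval by \<open>t \<mapsto> (1 + \<bar>t\<bar>) powr (- \<delta> / 2)\<close>, which is rounded to a uniform
grid (\<open>power_law_quantizer\<close>); the mean value theorem turns the grid width into the claimed
error. The weight is square integrable, so the cost is \<open>O(n powr (- 1 / d))\<close>
(\<open>q_GW_le_quantizer\<close>, \<open>q_GW_upper_bound\<close>).

Lower bound. Let \<open>\<pi>\<close> couple \<open>\<xi>\<close> with a measure on \<open>{1..n}\<close> with gauge \<open>G\<close>. Integrate the distortion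
\<open>x \<bullet> x' - G y y'\<close> against the vector \<open>x'\<close> over \<open>(x', y')\<close>. The scalar product yields \<open>S x\<close>, where
\<open>S\<close> is the matrix of second moments of \<open>\<xi>\<close>, and the gauge yields a vector \<open>b y\<close> that depends on \<open>y\<close>
only. By the Cauchy-Schwarz inequality the cost dominates the integral of \<open>norm (S x - b y) ^ 2\<close> up
to the second moment of \<open>\<xi>\<close>. Hyperplanes are null sets, hence \<open>S\<close> is invertible, and the cost
dominates a multiple of \<open>norm (x - c y) ^ 2\<close> with \<open>c y = inv S (b y)\<close>: it is at least the error of
quantising \<open>\<xi>\<close> by the \<open>n\<close> points \<open>c y\<close> (\<open>coupling_distortion_ge\<close>). That error is at least of
order \<open>n powr (- 1 / d)\<close>, because \<open>n\<close> balls of radius \<open>r\<close> have total volume at most a constant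
times \<open>n * r ^ d\<close>, and by absolute continuity sets of small volume carry at most half of the mass
(\<open>balls_capture_at_most_half\<close>).\<close>

section \<open>Couplings and finite gauged spaces\<close>

lemma discrete_in_GM:
  assumes "gm_space (T, g, \<xi>)" and "f \<in> \<xi> \<rightarrow>\<^sub>M count_space {1..n}"
    and "\<And>i j. G i j = G j i"
  shows "(discrete_topology {1..n}, G, distr \<xi> (count_space {1..n}) f) \<in> GM n"
  using assms by (auto simp: GM_def gm_space_def prob_space.prob_space_distr)

lemma GM_nonempty:
  assumes "gm_space (T, g, \<xi>)" and "n > 0"
  shows "GM n \<noteq> {}"
  using discrete_in_GM[OF assms(1), of "\<lambda>_. 1" n "\<lambda>_ _. 0"] assms(2) by auto

lemma GW2_bdd_below:
  "bdd_below ((\<lambda>\<pi>. sqrt (\<integral>((x, y), (x', y')). \<bar>g x x' - h y y'\<bar>\<^sup>2 \<partial>(\<pi> \<Otimes>\<^sub>M \<pi>))) ` A)"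
  by (rule bdd_belowI[of _ 0]) (auto intro!: Bochner_Integration.integral_nonneg)

lemma product_coupling:
  assumes "prob_space \<xi>" "prob_space \<upsilon>"
  shows "\<xi> \<Otimes>\<^sub>M \<upsilon> \<in> couplings \<xi> \<upsilon>"
proof -
  interpret \<xi>: prob_space \<xi> by fact
  interpret \<upsilon>: prob_space \<upsilon> by fact
  interpret P: pair_prob_space \<xi> \<upsilon> ..
  interpret Q: pair_prob_space \<upsilon> \<xi> ..
  have "distr (\<xi> \<Otimes>\<^sub>M \<upsilon>) \<upsilon> snd = distr (distr (\<xi> \<Otimes>\<^sub>M \<upsilon>) (\<upsilon> \<Otimes>\<^sub>M \<xi>) (\<lambda>(x, y). (y, x))) \<upsilon> fst"
    by (subst distr_distr) (auto simp: comp_def case_prod_beta' intro!: distr_cong)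
  also have "distr (\<xi> \<Otimes>\<^sub>M \<upsilon>) (\<upsilon> \<Otimes>\<^sub>M \<xi>) (\<lambda>(x, y). (y, x)) = \<upsilon> \<Otimes>\<^sub>M \<xi>"
    by (rule Q.distr_pair_swap[symmetric])
  finally have "distr (\<xi> \<Otimes>\<^sub>M \<upsilon>) \<upsilon> snd = \<upsilon>"
    by (simp add: \<xi>.distr_pair_fst)
  then show ?thesis
    using P.prob_space_axioms \<upsilon>.distr_pair_fst[of \<xi>] by (simp add: couplings_def)
qed

lemma GW2_nonneg:
  assumes "gm_space \<X>" "gm_space \<Y>"
  shows "0 \<le> GW2 \<X> \<Y>"
proof -
  obtain T g \<xi> S h \<upsilon> where XY: "\<X> = (T, g, \<xi>)" "\<Y> = (S, h, \<upsilon>)"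
    by (metis prod_cases3)
  then have "couplings \<xi> \<upsilon> \<noteq> {}"
    using assms product_coupling[of \<xi> \<upsilon>] by (auto simp: gm_space_def)
  then show ?thesis
    unfolding XY GW2_def prod.case
    by (rule cINF_greatest) (auto intro!: Bochner_Integration.integral_nonneg)
qed

text \<open>The cost of the deterministic coupling that sends \<open>x\<close> to \<open>f x\<close>.\<close>

lemma GW2_discrete_le:
  fixes n :: nat
  assumes X: "gm_space (T, g, \<xi>)" and f[measurable]: "f \<in> \<xi> \<rightarrow>\<^sub>M count_space {1..n}"
    and G: "\<And>i j. G i j = G j i"
  shows "GW2 (T, g, \<xi>) (discrete_topology {1..n}, G, distr \<xi> (count_space {1..n}) f)
    \<le> sqrt (\<integral>(x, x'). (g x x' - G (f x) (f x'))\<^sup>2 \<partial>(\<xi> \<Otimes>\<^sub>M \<xi>))"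
proof -
  define \<upsilon> where "\<upsilon> = distr \<xi> (count_space {1..n}) f"
  define \<pi> where "\<pi> = distr \<xi> (\<xi> \<Otimes>\<^sub>M \<upsilon>) (\<lambda>x. (x, f x))"
  have "prob_space \<xi>" using X by (simp add: gm_space_def)
  then interpret \<xi>: prob_space \<xi> .
  have fu[measurable]: "f \<in> \<xi> \<rightarrow>\<^sub>M \<upsilon>" using f by (simp add: \<upsilon>_def)
  have "prob_space \<upsilon>" unfolding \<upsilon>_def by (rule \<xi>.prob_space_distr[OF f])
  have pr: "(\<lambda>x. (x, f x)) \<in> \<xi> \<rightarrow>\<^sub>M \<xi> \<Otimes>\<^sub>M \<upsilon>" by measurable
  have "prob_space \<pi>" unfolding \<pi>_def by (rule \<xi>.prob_space_distr[OF pr])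
  have "distr \<pi> \<xi> fst = \<xi>"
    unfolding \<pi>_def by (subst distr_distr) (auto simp: comp_def pr)
  moreover have "distr \<pi> \<upsilon> snd = \<upsilon>"
  proof -
    have "distr \<pi> \<upsilon> snd = distr \<xi> \<upsilon> f"
      unfolding \<pi>_def using distr_distr[OF measurable_snd pr] by (simp add: comp_def)
    also have "\<dots> = \<upsilon>" unfolding \<upsilon>_def by (intro distr_cong) simp_all
    finally show ?thesis .
  qed
  ultimately have c: "\<pi> \<in> couplings \<xi> \<upsilon>"
    using \<open>prob_space \<pi>\<close> by (simp add: couplings_def \<pi>_def)
  have Y: "gm_space (discrete_topology {1..n}, G, \<upsilon>)"
    unfolding \<upsilon>_def by (rule GM_gm_space[OF discrete_in_GM[OF X f]]) (rule G)
  let ?F = "\<lambda>((x, y), (x', y')). \<bar>g x x' - G y y'\<bar>\<^sup>2"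
  have F: "?F \<in> borel_measurable (\<pi> \<Otimes>\<^sub>M \<pi>)"
    using GW_integrable[OF X Y c] by (rule borel_measurable_integrable)
  have "\<pi> \<Otimes>\<^sub>M \<pi> = distr (\<xi> \<Otimes>\<^sub>M \<xi>) ((\<xi> \<Otimes>\<^sub>M \<upsilon>) \<Otimes>\<^sub>M (\<xi> \<Otimes>\<^sub>M \<upsilon>))
      (\<lambda>(x, x'). ((x, f x), (x', f x')))"
    using pair_measure_distr[OF pr pr] \<open>prob_space \<pi>\<close>
    by (simp add: \<pi>_def prob_space_imp_sigma_finite)
  moreover have "(\<lambda>(x, x'). ((x, f x), (x', f x'))) \<in> \<xi> \<Otimes>\<^sub>M \<xi> \<rightarrow>\<^sub>M (\<xi> \<Otimes>\<^sub>M \<upsilon>) \<Otimes>\<^sub>M (\<xi> \<Otimes>\<^sub>M \<upsilon>)"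
    by measurable
  moreover have "?F \<in> borel_measurable ((\<xi> \<Otimes>\<^sub>M \<upsilon>) \<Otimes>\<^sub>M (\<xi> \<Otimes>\<^sub>M \<upsilon>))"
    using F by (simp add: \<pi>_def cong: measurable_cong_sets sets_pair_measure_cong)
  ultimately have "integral\<^sup>L (\<pi> \<Otimes>\<^sub>M \<pi>) ?F = (\<integral>(x, x'). (g x x' - G (f x) (f x'))\<^sup>2 \<partial>(\<xi> \<Otimes>\<^sub>M \<xi>))"
    by (simp add: integral_distr case_prod_beta')
  then show ?thesis
    using cINF_lower[OF GW2_bdd_below c, of g G] by (simp add: GW2_def \<upsilon>_def)
qed

text \<open>The \<open>\<sigma>\<close>-algebra of a gauged space is generated by the relatively open subsets of \<open>X\<close>.
Along this map its measure is transported to the Borel sets of the ambient space, where volumes of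
balls and hyperplanes are available.\<close>

lemma borel_measurable_restricted_identity:
  fixes X :: "'a::topological_space set"
  assumes "gm_space (top_of_set X, g, \<xi>)"
  shows "(\<lambda>x. x) \<in> borel_measurable \<xi>"
proof (rule borel_measurableI)
  fix S :: "'a set" assume "open S"
  then have "openin (top_of_set X) (X \<inter> S)" by (auto simp: openin_open)
  then have "X \<inter> S \<in> sets (borel_sigma (top_of_set X))"
    unfolding borel_sigma_def by (intro in_measure_of) (auto dest: openin_imp_subset)
  then show "(\<lambda>x. x) -` S \<inter> space \<xi> \<in> sets \<xi>"
    using assms by (simp add: gm_space_def Int_commute)
qed

section \<open>Upper bound by companded quantisation\<close>

text \<open>With \<open>u = (1 + \<bar>t\<bar>) powr - \<gamma>\<close>, which lies in \<open>(0, 1]\<close>, round \<open>u\<close> up to the next multiple \<open>u'\<close> of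
\<open>1 / m\<close>, map \<open>u'\<close> back to the line, and restore the sign of \<open>t\<close>. There are \<open>m\<close> levels and two
signs. Rounding up moves \<open>t\<close> towards 0, which gives the bound on \<open>q t\<close>. The inverse map
\<open>u \<mapsto> u powr (- 1 / \<gamma>)\<close> has derivative at most \<open>(1 + \<bar>t\<bar>) powr (1 + \<gamma>) / \<gamma>\<close> in absolute value to the
right of \<open>u\<close>.\<close>

lemma power_law_quantizer:
  fixes \<gamma> :: real and m :: nat
  assumes "\<gamma> > 0" "m > 0"
  obtains q S where "q \<in> borel_measurable borel" "\<And>t. q t \<in> S" "finite S" "card S \<le> 2 * m"
    and "\<And>t. \<bar>q t\<bar> \<le> \<bar>t\<bar>" and "\<And>t::real. \<bar>t - q t\<bar> \<le> (1 + \<bar>t\<bar>) powr (1 + \<gamma>) / (\<gamma> * m)"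
proof -
  define lev where "lev t = nat \<lceil>m * (1 + \<bar>t\<bar>) powr - \<gamma>\<rceil>" for t :: real
  define val where "val j = (real j / m) powr (- 1 / \<gamma>) - 1" for j
  define q where "q t = (if t < 0 then - val (lev t) else val (lev t))" for t
  define S where "S = val ` {1..m} \<union> (\<lambda>j. - val j) ` {1..m}"
  have lev: "lev t \<in> {1..m}" for t
  proof -
    have "(1 + \<bar>t\<bar>) powr - \<gamma> \<le> 1"
      using powr_mono2'[of "-\<gamma>" 1 "1 + \<bar>t\<bar>"] assms by simp
    then have "m * (1 + \<bar>t\<bar>) powr - \<gamma> \<le> real m * 1"
      by (intro mult_left_mono) auto
    moreover have "m * (1 + \<bar>t\<bar>) powr - \<gamma> > 0"
      using assms by (intro mult_pos_pos) auto
    ultimately show ?thesis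
      unfolding lev_def by (auto simp: nat_le_iff ceiling_le_iff Suc_le_eq)
  qed
  have err: "\<bar>q t\<bar> \<le> \<bar>t\<bar> \<and> \<bar>t - q t\<bar> \<le> (1 + \<bar>t\<bar>) powr (1 + \<gamma>) / (\<gamma> * m)" for t
  proof -
    define s where "s = 1 + \<bar>t\<bar>"
    define u where "u = s powr - \<gamma>"
    define u' where "u' = real (lev t) / m"
    have "s \<ge> 1" "s > 0" by (auto simp: s_def)
    then have "u > 0" by (simp add: u_def)
    have "real (lev t) = of_int \<lceil>m * u\<rceil>"
      using \<open>u > 0\<close> by (simp add: lev_def u_def s_def)
    then have "m * u \<le> lev t" "lev t \<le> m * u + 1"
      by linarith+
    then have "m * u / m \<le> u'" "u' \<le> (m * u + 1) / m"
      unfolding u'_def by (intro divide_right_mono; simp)+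
    then have u': "u \<le> u'" "u' - u \<le> 1 / m"
      using assms by (simp_all add: add_divide_distrib)
    have us: "u powr (- 1 / \<gamma>) = s"
      using assms \<open>s > 0\<close> by (simp add: u_def powr_powr)
    have us': "u powr (- 1 / \<gamma> - 1) = s powr (1 + \<gamma>)"
    proof -
      have "- \<gamma> * (- 1 / \<gamma> - 1) = 1 + \<gamma>" using assms by (simp add: field_simps)
      then show ?thesis by (simp add: u_def powr_powr)
    qed
    have low: "u' powr (- 1 / \<gamma>) \<le> s"
      using powr_mono2'[of "-1/\<gamma>" u u'] assms \<open>u > 0\<close> u' us by (simp add: field_simps)
    have high: "s - u' powr (- 1 / \<gamma>) \<le> s powr (1 + \<gamma>) / (\<gamma> * m)"
    proof (cases "u = u'")
      case True
      then show ?thesis using us assms by simp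
    next
      case False
      then have "u < u'" using u' by simp
      have "\<exists>z. u < z \<and> z < u' \<and> u' powr (- 1 / \<gamma>) - u powr (- 1 / \<gamma>)
          = (u' - u) * (- 1 / \<gamma> * z powr (- 1 / \<gamma> - 1))"
        using \<open>u > 0\<close> \<open>u < u'\<close>
        by (intro MVT2) (auto intro!: derivative_eq_intros simp: field_simps)
      then obtain z where z: "u < z" "u' powr (- 1 / \<gamma>) - s
          = (u' - u) * (- 1 / \<gamma> * z powr (- 1 / \<gamma> - 1))" using us by auto
      have "- 1 \<le> (0 :: real)" "0 \<le> 1 / \<gamma>" using assms by auto
      then have "- 1 \<le> 1 / \<gamma>" by (rule order.trans)
      then have "z powr (- 1 / \<gamma> - 1) \<le> s powr (1 + \<gamma>)"
        using powr_mono2'[of "-1/\<gamma> - 1" u z] \<open>u > 0\<close> z(1) assms us' by simp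
      then have "(u' - u) * (1 / \<gamma> * z powr (- 1 / \<gamma> - 1)) \<le> (1 / m) * (1 / \<gamma> * s powr (1 + \<gamma>))"
        using u' assms \<open>u < u'\<close> by (intro mult_mono) (auto intro!: divide_right_mono)
      then show ?thesis using z(2) by (simp add: mult_ac)
    qed
    have "0 < u'" "u' \<le> 1"
      using lev[of t] assms by (auto simp: u'_def)
    then have "1 \<le> u' powr (- 1 / \<gamma>)"
      using powr_mono2'[of "- 1 / \<gamma>" u' 1] assms by simp
    moreover have "\<bar>q t\<bar> = \<bar>u' powr (- 1 / \<gamma>) - 1\<bar>"
      by (auto simp: q_def val_def u'_def)
    moreover have "\<bar>t - q t\<bar> = \<bar>s - u' powr (- 1 / \<gamma>)\<bar>"
      by (auto simp: q_def val_def s_def u'_def)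
    ultimately show ?thesis using low high by (simp add: s_def)
  qed
  show thesis
  proof
    show "q \<in> borel_measurable borel"
      unfolding q_def val_def lev_def by measurable
    show "q t \<in> S" for t using lev[of t] by (auto simp: q_def S_def)
    show "finite S" by (simp add: S_def)
    have "card S \<le> card (val ` {1..m}) + card ((\<lambda>j. - val j) ` {1..m})"
      unfolding S_def by (rule card_Un_le)
    also have "\<dots> \<le> m + m"
      by (intro add_mono; (rule order.trans[OF card_image_le]; simp))
    finally show "card S \<le> 2 * m" by simp
    show "\<bar>q t\<bar> \<le> \<bar>t\<bar>" for t using err[of t] by simp
    show "\<bar>t - q t\<bar> \<le> (1 + \<bar>t\<bar>) powr (1 + \<gamma>) / (\<gamma> * m)" for t using err[of t] by simp
  qed
qed

text \<open>Quantising every coordinate separately costs only a factor depending on the dimension.\<close>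

lemma power_law_quantizer_vec:
  fixes \<gamma> :: real and m :: nat
  assumes "\<gamma> > 0" "m > 0"
  shows "\<exists>T :: real ^ 'd \<Rightarrow> real ^ 'd. T \<in> borel_measurable borel \<and>
    finite (range T) \<and> card (range T) \<le> (2 * m) ^ CARD('d) \<and>
    (\<forall>x. norm (T x) \<le> norm x \<and>
         norm (x - T x) \<le> CARD('d) / (\<gamma> * m) * (1 + norm x) powr (1 + \<gamma>))"
proof -
  obtain q S where q: "q \<in> borel_measurable borel" "\<And>t. q t \<in> S" "finite S" "card S \<le> 2 * m"
    and le: "\<And>t. \<bar>q t\<bar> \<le> \<bar>t\<bar>" and err: "\<And>t::real. \<bar>t - q t\<bar> \<le> (1 + \<bar>t\<bar>) powr (1 + \<gamma>) / (\<gamma> * m)"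
    using power_law_quantizer[OF assms] by blast
  define T where "T x = (\<chi> i. q (x $ i))" for x :: "real ^ 'd"
  define F where "F = (UNIV :: 'd set) \<rightarrow>\<^sub>E S"
  have sub: "range T \<subseteq> vec_lambda ` F"
    using q(2) by (auto simp: T_def F_def intro!: imageI)
  have "finite F" by (simp add: F_def q(3) finite_PiE)
  show ?thesis
  proof (intro exI[of _ T] conjI allI)
    note q(1)[measurable]
    have "(\<lambda>x :: real ^ 'd. q (x $ i)) \<in> borel_measurable borel" for i
      by (rule measurable_compose[OF _ q(1)]) (simp add: borel_measurable_continuous_onI continuous_intros)
    then show "T \<in> borel_measurable borel"
      unfolding T_def by (subst borel_measurable_euclidean_space)
        (auto simp: Basis_vec_def inner_axis)
    show "finite (range T)"
      using sub \<open>finite F\<close> by (meson finite_imageI finite_subset)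
    have "card (range T) \<le> card F"
      using sub \<open>finite F\<close> by (meson card_image_le card_mono finite_imageI le_trans)
    also have "\<dots> = card S ^ CARD('d)" by (simp add: F_def card_funcsetE)
    also have "\<dots> \<le> (2 * m) ^ CARD('d)" by (rule power_mono[OF q(4)]) simp
    finally show "card (range T) \<le> (2 * m) ^ CARD('d)" .
    show "norm (T x) \<le> norm x" for x
      by (rule norm_le_componentwise_cart) (simp add: T_def le)
    fix x :: "real ^ 'd"
    have "norm (x - T x) \<le> (\<Sum>i\<in>UNIV. \<bar>(x - T x) $ i\<bar>)"
      by (rule norm_le_l1_cart)
    also have "\<dots> \<le> (\<Sum>i\<in>(UNIV::'d set). (1 + norm x) powr (1 + \<gamma>) / (\<gamma> * m))"
    proof (rule sum_mono)
      fix i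
      have "\<bar>(x - T x) $ i\<bar> \<le> (1 + \<bar>x $ i\<bar>) powr (1 + \<gamma>) / (\<gamma> * m)"
        using err[of "x $ i"] by (simp add: T_def)
      also have "\<dots> \<le> (1 + norm x) powr (1 + \<gamma>) / (\<gamma> * m)"
        using component_le_norm_cart[of x i] assms
        by (intro divide_right_mono powr_mono2) auto
      finally show "\<bar>(x - T x) $ i\<bar> \<le> \<dots>" .
    qed
    finally show "norm (x - T x) \<le> CARD('d) / (\<gamma> * m) * (1 + norm x) powr (1 + \<gamma>)"
      by (simp add: mult_ac)
  qed
qed

text \<open>Both terms of \<open>x \<bullet> (x' - T x') + (x - T x) \<bullet> T x'\<close> are at most \<open>\<epsilon> * w x * w x'\<close>, a product of a
function of \<open>x\<close> and one of \<open>x'\<close>, so the square integrates to \<open>(2 * \<epsilon> * (\<integral>x. (w x)\<^sup>2 \<partial>\<xi>))\<^sup>2\<close>.\<close>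

lemma q_GW_le_quantizer:
  fixes X :: "'a::euclidean_space set"
  assumes X: "gm_space (top_of_set X, (\<lambda>x x'. x \<bullet> x'), \<xi>)"
    and T: "T \<in> borel_measurable borel" "finite (range T)" "card (range T) \<le> n"
    and w: "\<And>x. norm x \<le> w x" "\<And>x. norm (T x) \<le> w x" "\<And>x. norm (x - T x) \<le> \<epsilon> * w x"
    and w2: "integrable \<xi> (\<lambda>x. (w x)\<^sup>2)" and \<epsilon>: "\<epsilon> \<ge> 0"
  shows "q_GW n (top_of_set X, (\<lambda>x x'. x \<bullet> x'), \<xi>) \<le> 2 * \<epsilon> * (\<integral>x. (w x)\<^sup>2 \<partial>\<xi>)"
proof -
  let ?X = "(top_of_set X, (\<lambda>x x'. x \<bullet> x'), \<xi>)"
  have "prob_space \<xi>" using X by (simp add: gm_space_def)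
  then interpret \<xi>: prob_space \<xi> .
  interpret \<xi>\<xi>: pair_prob_space \<xi> \<xi> ..
  note idm = borel_measurable_restricted_identity[OF X]
  have Tm: "T \<in> borel_measurable \<xi>" by (rule measurable_compose[OF idm T(1)])
  obtain e where e: "inj_on e (range T)" "e ` range T \<subseteq> {1..n}"
    using card_le_inj[OF T(2), of "{1..n}"] T(3) by auto
  define f where "f x = e (T x)" for x
  (* The gauge on labels is the scalar product of the quantiser values that they encode. *)
  define d where "d = inv_into (range T) e"
  define G where "G i j = d i \<bullet> d j" for i j
  have df: "d (f x) = T x" for x using e(1) by (simp add: d_def f_def)
  have f: "f \<in> \<xi> \<rightarrow>\<^sub>M count_space {1..n}"
  proof (rule measurableI)
    show "f x \<in> space (count_space {1..n})" for x using e(2) by (simp add: f_def image_subset_iff)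
    fix A assume "A \<in> sets (count_space {1..n})"
    have "f -` A \<inter> space \<xi> = T -` (range T \<inter> e -` A) \<inter> space \<xi>"
      by (auto simp: f_def)
    also have "\<dots> \<in> sets \<xi>"
      using Tm by (rule measurable_sets) (auto intro!: borel_closed finite_imp_closed finite_Int T(2))
    finally show "f -` A \<inter> space \<xi> \<in> sets \<xi>" .
  qed
  have sym: "G i j = G j i" for i j by (simp add: G_def inner_commute)
  define \<Y> where "\<Y> = (discrete_topology {1..n}, G, distr \<xi> (count_space {1..n}) f)"
  have YGM: "\<Y> \<in> GM n" unfolding \<Y>_def by (rule discrete_in_GM[OF X f sym])
  have "q_GW n ?X \<le> GW2 ?X \<Y>"
    unfolding q_GW_def
    by (rule cINF_lower[OF bdd_belowI[of _ 0] YGM]) (auto intro!: GW2_nonneg X GM_gm_space)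
  also have "\<dots> \<le> sqrt (\<integral>(x, x'). (x \<bullet> x' - G (f x) (f x'))\<^sup>2 \<partial>(\<xi> \<Otimes>\<^sub>M \<xi>))"
    unfolding \<Y>_def by (rule GW2_discrete_le[OF X f sym])
  also have "\<dots> \<le> sqrt ((2 * \<epsilon> * (\<integral>x. (w x)\<^sup>2 \<partial>\<xi>))\<^sup>2)"
  proof (rule real_sqrt_le_mono)
    have w0: "w x \<ge> 0" for x using w(1)[of x] norm_ge_zero[of x] by linarith
    have pt: "(x \<bullet> x' - G (f x) (f x'))\<^sup>2 \<le> (2 * \<epsilon>)\<^sup>2 * ((w x)\<^sup>2 * (w x')\<^sup>2)" for x x'
    proof -
      have "x \<bullet> x' - G (f x) (f x') = x \<bullet> (x' - T x') + (x - T x) \<bullet> T x'"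
        by (simp add: G_def df inner_diff_left inner_diff_right)
      then have "\<bar>x \<bullet> x' - G (f x) (f x')\<bar> \<le> norm x * norm (x' - T x') + norm (x - T x) * norm (T x')"
        using Cauchy_Schwarz_ineq2[of x "x' - T x'"] Cauchy_Schwarz_ineq2[of "x - T x" "T x'"]
        by linarith
      also have "\<dots> \<le> w x * (\<epsilon> * w x') + (\<epsilon> * w x) * w x'"
        using w w0 \<epsilon> by (intro add_mono mult_mono) auto
      also have "\<dots> = \<bar>2 * \<epsilon> * (w x * w x')\<bar>" using w0 \<epsilon> by simp
      finally show ?thesis
        by (simp add: abs_le_square_iff power_mult_distrib)
    qed
    have i: "integrable (\<xi> \<Otimes>\<^sub>M \<xi>) (\<lambda>(x, x'). (2 * \<epsilon>)\<^sup>2 * ((w x)\<^sup>2 * (w x')\<^sup>2))"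
    proof -
      have "(\<lambda>(x, x'). (2 * \<epsilon>)\<^sup>2 * ((w x)\<^sup>2 * (w x')\<^sup>2)) \<in> borel_measurable (\<xi> \<Otimes>\<^sub>M \<xi>)"
        using borel_measurable_integrable[OF w2] by measurable
      then show ?thesis
        using w2 by (intro \<xi>\<xi>.Fubini_integrable) (auto simp: abs_mult)
    qed
    have "(\<integral>(x, x'). (x \<bullet> x' - G (f x) (f x'))\<^sup>2 \<partial>(\<xi> \<Otimes>\<^sub>M \<xi>))
      \<le> (\<integral>(x, x'). (2 * \<epsilon>)\<^sup>2 * ((w x)\<^sup>2 * (w x')\<^sup>2) \<partial>(\<xi> \<Otimes>\<^sub>M \<xi>))"
      by (intro integral_mono_AE'[OF i] AE_I2) (simp_all only: split_beta pt, simp)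
    also have "\<dots> = (2 * \<epsilon> * (\<integral>x. (w x)\<^sup>2 \<partial>\<xi>))\<^sup>2"
    proof -
      have "(2 * \<epsilon>)\<^sup>2 * (I * I) = (2 * \<epsilon> * I)\<^sup>2" for I
        by (simp add: power2_eq_square)
      then show ?thesis using \<xi>\<xi>.integral_fst'[OF i] by simp
    qed
    finally show "(\<integral>(x, x'). (x \<bullet> x' - G (f x) (f x'))\<^sup>2 \<partial>(\<xi> \<Otimes>\<^sub>M \<xi>))
      \<le> (2 * \<epsilon> * (\<integral>x. (w x)\<^sup>2 \<partial>\<xi>))\<^sup>2" .
  qed
  also have "\<dots> = 2 * \<epsilon> * (\<integral>x. (w x)\<^sup>2 \<partial>\<xi>)"
    using \<epsilon> by (simp add: Bochner_Integration.integral_nonneg)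
  finally show ?thesis .
qed

text \<open>Each coordinate may use about \<open>n powr (1 / d)\<close> values, that is \<open>m\<close> levels of each sign with
\<open>m = \<lfloor>n powr (1 / d) / 2\<rfloor>\<close>; the condition \<open>n \<ge> 2 ^ d\<close> ensures \<open>m \<ge> 1\<close>.\<close>

lemma q_GW_upper_bound:
  fixes X :: "(real ^ 'd) set"
  assumes X: "gm_space (top_of_set X, (\<lambda>x x'. x \<bullet> x'), \<xi>)" and \<gamma>: "\<gamma> > 0"
    and i: "integrable \<xi> (\<lambda>x. ((1 + norm x) powr (1 + \<gamma>))\<^sup>2)"
  obtains c where
    "\<And>n. n \<ge> 2 ^ CARD('d) \<Longrightarrow>
       real n powr (1 / CARD('d)) * q_GW n (top_of_set X, (\<lambda>x x'. x \<bullet> x'), \<xi>) \<le> c"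
proof -
  define w where "w x = (1 + norm x) powr (1 + \<gamma>)" for x :: "real ^ 'd"
  define I where "I = (\<integral>x. (w x)\<^sup>2 \<partial>\<xi>)"
  have "I \<ge> 0" by (simp add: I_def Bochner_Integration.integral_nonneg)
  have w: "norm x \<le> w x" for x
  proof -
    have "1 + norm x \<le> (1 + norm x) powr (1 + \<gamma>)"
      using powr_mono[of 1 "1 + \<gamma>" "1 + norm x"] \<gamma> by simp
    then show ?thesis by (simp add: w_def)
  qed
  show thesis
  proof (rule that)
    fix n :: nat assume n: "n \<ge> 2 ^ CARD('d)"
    define R where "R = real n powr (1 / CARD('d))"
    have "real n > 0" using n by (auto intro: gr0I)
    have Rd: "R ^ CARD('d) = n"
      using \<open>real n > 0\<close> by (simp add: R_def powr_powr flip: powr_realpow)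
    have "2 ^ CARD('d) \<le> R ^ CARD('d)" unfolding Rd using n by (simp add: of_nat_le_iff[symmetric])
    then have "R \<ge> 2" using power_mono_iff[of 2 R "CARD('d)"] by (simp add: R_def)
    define m where "m = nat \<lfloor>R / 2\<rfloor>"
    have "real m = of_int \<lfloor>R / 2\<rfloor>" using \<open>R \<ge> 2\<close> by (simp add: m_def)
    then have m: "real m \<le> R / 2" "R / 2 < real m + 1" by linarith+
    have "m > 0" using \<open>R \<ge> 2\<close> by (simp add: m_def)
    have "R / 4 \<le> m" using m \<open>m > 0\<close> by linarith
    obtain T :: "real ^ 'd \<Rightarrow> real ^ 'd" where T: "T \<in> borel_measurable borel"
      "finite (range T)" "card (range T) \<le> (2 * m) ^ CARD('d)"
      and bounds: "\<forall>x. norm (T x) \<le> norm x \<and>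
        norm (x - T x) \<le> CARD('d) / (\<gamma> * m) * (1 + norm x) powr (1 + \<gamma>)"
      using power_law_quantizer_vec[where 'd = 'd, OF \<gamma> \<open>m > 0\<close>] by (elim exE conjE)
    have "real (2 * m) \<le> R" using m by simp
    then have "real (2 * m) ^ CARD('d) \<le> R ^ CARD('d)" by (rule power_mono) simp
    then have "real ((2 * m) ^ CARD('d)) \<le> R ^ CARD('d)" by (simp only: of_nat_power)
    then have "card (range T) \<le> n" using T(3) unfolding Rd by linarith
    then have "q_GW n (top_of_set X, (\<lambda>x x'. x \<bullet> x'), \<xi>) \<le> 2 * (CARD('d) / (\<gamma> * m)) * I"
      unfolding I_def
    proof (rule q_GW_le_quantizer[OF X T(1,2) _ w])
      show "norm (T x) \<le> w x" for x using bounds w[of x] by (meson order.trans)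
      show "norm (x - T x) \<le> CARD('d) / (\<gamma> * m) * w x" for x using bounds by (simp only: w_def)
      show "integrable \<xi> (\<lambda>x. (w x)\<^sup>2)" using i by (simp only: w_def)
      show "0 \<le> CARD('d) / (\<gamma> * m)" using \<gamma> by simp
    qed
    then have "R * q_GW n (top_of_set X, (\<lambda>x x'. x \<bullet> x'), \<xi>) \<le> R * (2 * (CARD('d) / (\<gamma> * m)) * I)"
      using \<open>R \<ge> 2\<close> by (intro mult_left_mono) auto
    also have "\<dots> = (R / m) * (2 * CARD('d) * I / \<gamma>)" by simp
    also have "\<dots> \<le> 4 * (2 * CARD('d) * I / \<gamma>)"
      using \<open>R / 4 \<le> m\<close> \<open>m > 0\<close> \<open>I \<ge> 0\<close> \<gamma>
      by (intro mult_right_mono) (auto simp: field_simps)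
    finally show "R * q_GW n (top_of_set X, (\<lambda>x x'. x \<bullet> x'), \<xi>) \<le> 4 * (2 * CARD('d) * I / \<gamma>)" .
  qed
qed

section \<open>Small balls under an absolutely continuous measure\<close>

text \<open>The \<open>\<epsilon>\<close>-\<open>\<eta>\<close> form of absolute continuity. Otherwise there are sets \<open>A k\<close> with \<open>N\<close>-measure at most
\<open>2 ^ (- k)\<close> and \<open>M\<close>-measure at least \<open>\<epsilon>\<close>; by the Borel-Cantelli lemma their limit superior is an
\<open>N\<close>-null set and hence an \<open>M\<close>-null set, but by continuity from above its \<open>M\<close>-measure is at least \<open>\<epsilon>\<close>.\<close>

lemma absolutely_continuous_small_set:
  assumes M: "finite_measure M" "sets M = sets N" "absolutely_continuous N M" and \<epsilon>: "\<epsilon> > 0"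
  obtains \<eta> where "\<eta> > 0" "\<And>A. A \<in> sets N \<Longrightarrow> emeasure N A \<le> ennreal \<eta> \<Longrightarrow> measure M A < \<epsilon>"
proof (rule ccontr)
  interpret finite_measure M by fact
  assume "\<not> thesis"
  have "\<exists>A. A \<in> sets N \<and> emeasure N A \<le> ennreal ((1/2) ^ k) \<and> \<epsilon> \<le> measure M A" for k :: nat
  proof (rule ccontr)
    assume "\<not> ?thesis"
    then have small: "\<And>A. A \<in> sets N \<Longrightarrow> emeasure N A \<le> ennreal ((1/2) ^ k) \<Longrightarrow> measure M A < \<epsilon>"
      by (metis not_le)
    have "thesis" by (rule that[of "(1/2) ^ k"]) (simp, rule small)
    with \<open>\<not> thesis\<close> show False ..
  qed
  then obtain A where A: "\<And>k. A k \<in> sets N" "\<And>k. emeasure N (A k) \<le> ennreal ((1/2) ^ k)"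
      "\<And>k. measure M (A k) \<ge> \<epsilon>"
    by metis
  have fin: "emeasure N (A k) < \<infinity>" for k
    using A(2)[of k] by (simp add: le_less_trans)
  have "summable (\<lambda>k. measure N (A k))"
  proof (rule summable_comparison_test')
    show "summable (\<lambda>k. (1/2 :: real) ^ k)" by simp
    show "norm (measure N (A k)) \<le> (1/2) ^ k" if "k \<ge> 0" for k
      using A(2)[of k] by (simp add: measure_def enn2real_leI)
  qed
  from borel_cantelli_limsup1[OF A(1) fin this] have "limsup A \<in> null_sets M"
    using M(3) by (auto simp: absolutely_continuous_def)
  then have null: "measure M (limsup A) = 0" by (simp add: measure_def null_sets_def)
  define B where "B n = (\<Union>k\<in>{n..}. A k)" for n
  have As: "A k \<in> sets M" for k using A(1) M(2) by simp
  have Bs: "B n \<in> sets M" for n unfolding B_def using As by (intro sets.countable_UN') auto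
  have "(\<lambda>n. measure M (B n)) \<longlonglongrightarrow> measure M (\<Inter>n. B n)"
  proof (rule finite_Lim_measure_decseq)
    show "decseq B" unfolding decseq_def B_def by (intro allI impI UN_mono) auto
  qed (use Bs in auto)
  moreover have "(\<Inter>n. B n) = limsup A" by (simp add: limsup_INF_SUP B_def)
  moreover have "\<epsilon> \<le> measure M (B n)" for n
    using A(3)[of n] finite_measure_mono[of "A n" "B n"] Bs by (force simp: B_def)
  ultimately have "\<epsilon> \<le> measure M (limsup A)"
    using LIMSEQ_le_const[of "\<lambda>n. measure M (B n)" "measure M (limsup A)" \<epsilon>] by auto
  then show False using null \<epsilon> by simp
qed

text \<open>The radius is chosen so that \<open>n\<close> balls have total volume at most \<open>\<eta>\<close>, which is too small
for more than half of the mass.\<close>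

lemma balls_capture_at_most_half:
  fixes M :: "'a::euclidean_space measure"
  assumes M: "finite_measure M" "sets M = sets borel" "absolutely_continuous lborel M"
  obtains c where "c > 0"
    "\<And>n C. n > 0 \<Longrightarrow> finite C \<Longrightarrow> card C \<le> n \<Longrightarrow>
       measure M (\<Union>a\<in>C. ball a (c * real n powr (- 1 / DIM('a)))) \<le> 1 / 2"
proof -
  obtain \<eta> where \<eta>: "\<eta> > 0"
    "\<And>A. A \<in> sets borel \<Longrightarrow> emeasure lborel A \<le> ennreal \<eta> \<Longrightarrow> measure M A < 1/2"
    using absolutely_continuous_small_set[of M lborel "1/2"] M by auto
  define V where "V = unit_ball_vol (DIM('a))"
  have "V > 0" by (simp add: V_def)
  define c where "c = (\<eta> / V) powr (1 / DIM('a))"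
  have "c > 0" using \<eta> \<open>V > 0\<close> by (simp add: c_def)
  have cp: "V * c ^ DIM('a) = \<eta>"
    using \<eta>(1) \<open>V > 0\<close> \<open>c > 0\<close>
    by (simp add: c_def powr_powr flip: powr_realpow)
  show thesis
  proof
    show "c > 0" by fact
    fix n :: nat and C :: "'a set"
    assume n: "n > 0" and C: "finite C" "card C \<le> n"
    define r where "r = c * real n powr (- 1 / DIM('a))"
    have "r > 0" using n \<open>c > 0\<close> by (simp add: r_def)
    have "(real n powr (- 1 / DIM('a))) ^ DIM('a) = real n powr (- 1)"
      using n by (simp add: powr_powr flip: powr_realpow)
    moreover have "V * r ^ DIM('a) = V * c ^ DIM('a) * (real n powr (- 1 / DIM('a))) ^ DIM('a)"
      by (simp add: r_def power_mult_distrib)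
    ultimately have vol: "V * r ^ DIM('a) = \<eta> / n"
      unfolding cp by (simp add: powr_minus_divide)
    have "emeasure lborel (\<Union>a\<in>C. ball a r) \<le> (\<Sum>a\<in>C. emeasure lborel (ball a r))"
      using C by (intro emeasure_subadditive_finite) auto
    also have "\<dots> = ennreal (card C * (\<eta> / n))"
      using \<open>r > 0\<close> \<eta>(1) by (simp add: emeasure_ball vol[unfolded V_def] ennreal_of_nat_eq_real_of_nat
          flip: ennreal_mult)
    also have "\<dots> \<le> ennreal \<eta>"
      using C n \<eta>(1) by (intro ennreal_leI) (simp add: field_simps)
    finally have "measure M (\<Union>a\<in>C. ball a r) < 1/2"
      by (intro \<eta>(2)) (use C in auto)
    then show "measure M (\<Union>a\<in>C. ball a (c * real n powr (- 1 / DIM('a)))) \<le> 1 / 2"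
      by (simp add: r_def)
  qed
qed

section \<open>The second moment operator\<close>

definition second_moment_operator :: "'a::euclidean_space measure \<Rightarrow> 'a \<Rightarrow> 'a" where
  "second_moment_operator M v = (\<integral>x. (v \<bullet> x) *\<^sub>R x \<partial>M)"

lemma integrable_inner_scaleR:
  fixes M :: "'a::euclidean_space measure"
  assumes "sets M = sets borel" "integrable M (\<lambda>x. (norm x)\<^sup>2)"
  shows "integrable M (\<lambda>x. (v \<bullet> x) *\<^sub>R x)"
proof (rule Bochner_Integration.integrable_bound)
  show "integrable M (\<lambda>x. norm v * (norm x)\<^sup>2)" using assms by simp
  have "(\<lambda>x. (v \<bullet> x) *\<^sub>R x) \<in> borel_measurable borel" by measurable
  then show "(\<lambda>x. (v \<bullet> x) *\<^sub>R x) \<in> borel_measurable M"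
    by (simp add: measurable_cong_sets[OF assms(1) refl])
  have "\<bar>v \<bullet> x\<bar> * norm x \<le> norm v * norm x * norm x" for x
    by (intro mult_right_mono Cauchy_Schwarz_ineq2) auto
  then show "AE x in M. norm ((v \<bullet> x) *\<^sub>R x) \<le> norm (norm v * (norm x)\<^sup>2)"
    by (simp add: power2_eq_square mult.assoc)
qed

lemma linear_second_moment_operator:
  assumes "sets M = sets borel" "integrable M (\<lambda>x. (norm x)\<^sup>2)"
  shows "linear (second_moment_operator M)"
  by (rule linearI)
     (simp_all add: second_moment_operator_def inner_add_left scaleR_add_left
        Bochner_Integration.integral_add integrable_inner_scaleR[OF assms]
        flip: scaleR_scaleR)

text \<open>The quadratic form \<open>v \<bullet> S v = (\<integral>x. (v \<bullet> x)\<^sup>2 \<partial>M)\<close> vanishes only if \<open>M\<close> is concentrated on the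
hyperplane orthogonal to \<open>v\<close>.\<close>

lemma inj_second_moment_operator:
  fixes M :: "'a::euclidean_space measure"
  assumes "prob_space M" "sets M = sets borel" "absolutely_continuous lborel M"
    and i: "integrable M (\<lambda>x. (norm x)\<^sup>2)"
  shows "inj (second_moment_operator M)"
proof -
  interpret prob_space M by fact
  have "v = 0" if v: "second_moment_operator M v = 0" for v
  proof (rule ccontr)
    assume "v \<noteq> 0"
    note int = integrable_inner_scaleR[OF assms(2) i, of v]
    have int2: "integrable M (\<lambda>x. (v \<bullet> x)\<^sup>2)"
      using integrable_inner_right[OF int, of v] by (simp add: power2_eq_square)
    have "(\<integral>x. (v \<bullet> x)\<^sup>2 \<partial>M) = v \<bullet> second_moment_operator M v"
      unfolding second_moment_operator_def
      using integral_inner_right[OF int, of v] by (simp add: power2_eq_square)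
    then have "(\<integral>x. (v \<bullet> x)\<^sup>2 \<partial>M) = 0" using v by simp
    then have "AE x in M. v \<bullet> x = 0"
      using integral_nonneg_eq_0_iff_AE[OF int2] by simp
    moreover have "AE x in M. v \<bullet> x \<noteq> 0"
    proof -
      have "negligible {x. v \<bullet> x = 0}" using \<open>v \<noteq> 0\<close> by (intro negligible_hyperplane) auto
      moreover have "closed {x. v \<bullet> x = 0}" by (rule closed_hyperplane)
      ultimately have "{x. v \<bullet> x = 0} \<in> null_sets lborel"
        by (simp add: negligible_iff_null_sets null_sets_completion_iff)
      then have "{x. v \<bullet> x = 0} \<in> null_sets M"
        using assms(3) by (auto simp: absolutely_continuous_def)
      from AE_not_in[OF this] show ?thesis by simp
    qed
    ultimately have "AE x in M. False" by eventually_elim simp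
    then show False by simp
  qed
  then show ?thesis
    by (simp add: linear_injective_0[OF linear_second_moment_operator[OF assms(2) i]])
qed

section \<open>Lower bound by averaging the distortion\<close>

text \<open>The right-hand side is an extended non-negative integral, so that for a distortion \<open>h\<close> depending
on a further variable it integrates over that variable to the full cost.\<close>

lemma norm_integral_scaleR_le:
  fixes Z :: "'b \<Rightarrow> 'a::euclidean_space"
  assumes [measurable]: "h \<in> borel_measurable P" "Z \<in> borel_measurable P"
    and Z: "integrable P (\<lambda>w. (norm (Z w))\<^sup>2)"
  shows "ennreal ((norm (\<integral>w. h w *\<^sub>R Z w \<partial>P))\<^sup>2)
    \<le> ennreal (\<integral>w. (norm (Z w))\<^sup>2 \<partial>P) * (\<integral>\<^sup>+w. ennreal ((h w)\<^sup>2) \<partial>P)"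
proof -
  have "ennreal (norm (\<integral>w. h w *\<^sub>R Z w \<partial>P)) \<le> (\<integral>\<^sup>+w. ennreal (norm (Z w)) * ennreal \<bar>h w\<bar> \<partial>P)"
    using integral_norm_bound_ennreal[of P "\<lambda>w. h w *\<^sub>R Z w"]
    by (cases "integrable P (\<lambda>w. h w *\<^sub>R Z w)")
       (simp_all add: ennreal_mult mult.commute not_integrable_integral_eq)
  then have "(ennreal (norm (\<integral>w. h w *\<^sub>R Z w \<partial>P)))\<^sup>2
      \<le> (\<integral>\<^sup>+w. ennreal (norm (Z w)) * ennreal \<bar>h w\<bar> \<partial>P)\<^sup>2"
    by (intro power_mono) auto
  also have "\<dots> \<le> (\<integral>\<^sup>+w. (ennreal (norm (Z w)))\<^sup>2 \<partial>P) * (\<integral>\<^sup>+w. (ennreal \<bar>h w\<bar>)\<^sup>2 \<partial>P)"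
    by (rule Cauchy_Schwarz_nn_integral) auto
  finally show ?thesis
    by (simp add: ennreal_power nn_integral_eq_integral[OF Z])
qed

text \<open>The coupling is presented as a probability space \<open>P\<close> with the two coordinates \<open>Z\<close> and \<open>Y\<close>. For each
label \<open>j\<close> the gauge contributes the vector \<open>b j = (\<integral>w. G j (Y w) *\<^sub>R Z w \<partial>P)\<close>, and
\<open>S (Z w) - b (Y w)\<close> is the integral over \<open>w'\<close> of the distortion times \<open>Z w'\<close>. Pulling \<open>b j\<close> back
by \<open>S\<close> gives the centre \<open>c j\<close> that replaces label \<open>j\<close>; with probability at least one half \<open>Z w\<close> has
distance at least \<open>r\<close> from all \<open>n\<close> centres.\<close>

lemma coupling_distortion_ge:
  fixes Z :: "'b \<Rightarrow> 'a::euclidean_space" and Y :: "'b \<Rightarrow> nat"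
  assumes P: "prob_space P"
    and Z[measurable]: "Z \<in> borel_measurable P" and Y[measurable]: "Y \<in> P \<rightarrow>\<^sub>M count_space {1..n}"
    and M: "distr P borel Z = M" and i: "integrable M (\<lambda>x. (norm x)\<^sup>2)"
    and \<kappa>: "\<kappa> > 0" "\<And>v. \<kappa> * norm v \<le> norm (second_moment_operator M v)"
    and r: "r > 0" "\<And>C. finite C \<Longrightarrow> card C \<le> n \<Longrightarrow> measure M (\<Union>a\<in>C. ball a r) \<le> 1 / 2"
  shows "ennreal (\<kappa>\<^sup>2 * r\<^sup>2 / 2) \<le> ennreal (\<integral>x. (norm x)\<^sup>2 \<partial>M) *
    (\<integral>\<^sup>+w. \<integral>\<^sup>+w'. ennreal ((Z w \<bullet> Z w' - G (Y w) (Y w'))\<^sup>2) \<partial>P \<partial>P)"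
proof -
  interpret prob_space P by fact
  have sM: "sets M = sets borel" using M by auto
  have iZ: "integrable P (\<lambda>w. (norm (Z w))\<^sup>2)"
    using i unfolding M[symmetric] by (subst (asm) integrable_distr_eq) auto
  have mom: "(\<integral>x. (norm x)\<^sup>2 \<partial>M) = (\<integral>w. (norm (Z w))\<^sup>2 \<partial>P)"
    unfolding M[symmetric] by (subst integral_distr) auto
  have iZ1: "integrable P Z"
  proof (rule Bochner_Integration.integrable_bound)
    show "integrable P (\<lambda>w. 1 + (norm (Z w))\<^sup>2)" using iZ by simp
    have "t \<le> 1 + t\<^sup>2" for t :: real
      using zero_le_power2[of "t - 1 / 2"] by (simp add: power2_eq_square algebra_simps)
    then show "AE w in P. norm (Z w) \<le> norm (1 + (norm (Z w))\<^sup>2)" by simp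
  qed (rule Z)
  define b where "b j = (\<integral>w. G j (Y w) *\<^sub>R Z w \<partial>P)" for j
  have Gm[measurable]: "(\<lambda>w. G j (Y w)) \<in> borel_measurable P" for j
    by (rule measurable_compose[OF Y]) simp
  have ib: "integrable P (\<lambda>w. G j (Y w) *\<^sub>R Z w)" for j
  proof (rule Bochner_Integration.integrable_bound)
    define K where "K = Max ((\<lambda>k. \<bar>G j k\<bar>) ` {1..n})"
    show "integrable P (\<lambda>w. K *\<^sub>R Z w)" using iZ1 by simp
    show "AE w in P. norm (G j (Y w) *\<^sub>R Z w) \<le> norm (K *\<^sub>R Z w)"
    proof (rule AE_I2)
      fix w assume "w \<in> space P"
      then have "\<bar>G j (Y w)\<bar> \<le> K"
        using measurable_space[OF Y, of w] unfolding K_def by (intro Max_ge) auto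
      then show "norm (G j (Y w) *\<^sub>R Z w) \<le> norm (K *\<^sub>R Z w)"
        by (auto intro!: mult_right_mono)
    qed
  qed measurable
  have iq: "integrable P (\<lambda>w. (v \<bullet> Z w) *\<^sub>R Z w)" for v
    using integrable_inner_scaleR[OF sM i, of v]
    unfolding M[symmetric] by (subst (asm) integrable_distr_eq) auto
  have op: "second_moment_operator M v = (\<integral>w. (v \<bullet> Z w) *\<^sub>R Z w \<partial>P)" for v
    unfolding second_moment_operator_def M[symmetric] by (subst integral_distr) auto
  have inj: "inj (second_moment_operator M)"
    unfolding linear_injective_0[OF linear_second_moment_operator[OF sM i]]
    using \<kappa> by (metis mult_pos_pos norm_zero not_le zero_less_norm_iff)
  then have surj: "surj (second_moment_operator M)"
    by (rule linear_inj_imp_surj[OF linear_second_moment_operator[OF sM i]])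
  define c where "c j = inv (second_moment_operator M) (b j)" for j
  have c: "second_moment_operator M (c j) = b j" for j
    unfolding c_def by (rule surj_f_inv_f[OF surj])
  let ?D = "\<lambda>w. \<integral>\<^sup>+w'. ennreal ((Z w \<bullet> Z w' - G (Y w) (Y w'))\<^sup>2) \<partial>P"
  have pointwise: "ennreal (\<kappa>\<^sup>2 * (norm (Z w - c (Y w)))\<^sup>2) \<le> ennreal (\<integral>x. (norm x)\<^sup>2 \<partial>M) * ?D w" for w
  proof -
    have "second_moment_operator M (Z w - c (Y w)) = second_moment_operator M (Z w) - b (Y w)"
      by (simp only: linear_diff[OF linear_second_moment_operator[OF sM i]] c)
    also have "\<dots> = (\<integral>w'. (Z w \<bullet> Z w') *\<^sub>R Z w' \<partial>P) - (\<integral>w'. G (Y w) (Y w') *\<^sub>R Z w' \<partial>P)"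
      by (simp only: op[of "Z w"] b_def)
    also have "\<dots> = (\<integral>w'. (Z w \<bullet> Z w' - G (Y w) (Y w')) *\<^sub>R Z w' \<partial>P)"
      by (simp add: scaleR_diff_left Bochner_Integration.integral_diff[OF iq ib])
    finally have S: "second_moment_operator M (Z w - c (Y w)) = \<dots>" .
    have "\<kappa>\<^sup>2 * (norm (Z w - c (Y w)))\<^sup>2 \<le> (norm (second_moment_operator M (Z w - c (Y w))))\<^sup>2"
      using \<kappa>(1) \<kappa>(2)[of "Z w - c (Y w)"] by (simp add: power_mono flip: power_mult_distrib)
    then have "ennreal (\<kappa>\<^sup>2 * (norm (Z w - c (Y w)))\<^sup>2)
        \<le> ennreal ((norm (second_moment_operator M (Z w - c (Y w))))\<^sup>2)"
      by (rule ennreal_leI)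
    also have "\<dots> \<le> ennreal (\<integral>w. (norm (Z w))\<^sup>2 \<partial>P) * ?D w"
      unfolding S by (rule norm_integral_scaleR_le) (auto intro: iZ)
    finally show ?thesis by (simp add: mom)
  qed
  define B where "B = (\<Union>a\<in>c ` {1..n}. ball a r)"
  have B[measurable]: "B \<in> sets borel" by (simp add: B_def)
  have half: "measure M B \<le> 1 / 2"
    unfolding B_def by (rule r(2)) (auto intro: order.trans[OF card_image_le])
  define E where "E = Z -` (- B) \<inter> space P"
  have E: "E \<in> sets P" unfolding E_def by measurable
  have "measure P E = 1 - measure M B"
  proof -
    have "measure M B = measure P (Z -` B \<inter> space P)"
      unfolding M[symmetric] by (rule measure_distr) auto
    moreover have "E = space P - (Z -` B \<inter> space P)" by (auto simp: E_def)
    ultimately show ?thesis by (simp add: prob_compl)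
  qed
  then have "1 / 2 \<le> measure P E" using half by linarith
  then have "\<kappa>\<^sup>2 * r\<^sup>2 * (1 / 2) \<le> \<kappa>\<^sup>2 * r\<^sup>2 * measure P E"
    by (rule mult_left_mono) simp
  then have "ennreal (\<kappa>\<^sup>2 * r\<^sup>2 / 2) \<le> ennreal (\<kappa>\<^sup>2 * r\<^sup>2) * emeasure P E"
    by (simp add: emeasure_eq_measure ennreal_leI flip: ennreal_mult)
  also have "\<dots> = (\<integral>\<^sup>+w. ennreal (\<kappa>\<^sup>2 * r\<^sup>2) * indicator E w \<partial>P)"
    by (simp add: nn_integral_cmult_indicator E)
  also have "\<dots> \<le> (\<integral>\<^sup>+w. ennreal (\<integral>x. (norm x)\<^sup>2 \<partial>M) * ?D w \<partial>P)"
  proof (rule nn_integral_mono)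
    fix w assume w: "w \<in> space P"
    show "ennreal (\<kappa>\<^sup>2 * r\<^sup>2) * indicator E w \<le> ennreal (\<integral>x. (norm x)\<^sup>2 \<partial>M) * ?D w"
    proof (cases "w \<in> E")
      case True
      have "Y w \<in> {1..n}" using measurable_space[OF Y w] by simp
      then have "r \<le> norm (Z w - c (Y w))"
        using True by (force simp: E_def B_def dist_norm norm_minus_commute not_less)
      then have "\<kappa>\<^sup>2 * r\<^sup>2 \<le> \<kappa>\<^sup>2 * (norm (Z w - c (Y w)))\<^sup>2"
        using r(1) by (intro mult_left_mono power_mono) auto
      from order.trans[OF ennreal_leI[OF this] pointwise[of w]] show ?thesis
        using True by simp
    qed simp
  qed
  also have "\<dots> = ennreal (\<integral>x. (norm x)\<^sup>2 \<partial>M) * (\<integral>\<^sup>+w. ?D w \<partial>P)"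
  proof (rule nn_integral_cmult)
    have "(\<lambda>(w, w'). G (Y w) (Y w')) \<in> borel_measurable (P \<Otimes>\<^sub>M P)"
    proof -
      have "(\<lambda>p. G (Y (fst p)) (Y (snd p))) \<in> borel_measurable (P \<Otimes>\<^sub>M P)"
      proof (rule measurable_compose_countable'
          [where I = "{1..n}" and g = "\<lambda>p. Y (fst p)" and f = "\<lambda>j p. G j (Y (snd p))"])
        show "(\<lambda>p. G j (Y (snd p))) \<in> borel_measurable (P \<Otimes>\<^sub>M P)" for j
          by (rule measurable_compose[OF measurable_snd Gm])
        show "(\<lambda>p. Y (fst p)) \<in> P \<Otimes>\<^sub>M P \<rightarrow>\<^sub>M count_space {1..n}"
          by (rule measurable_compose[OF measurable_fst Y])
      qed (rule countable_finite, simp)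
      then show ?thesis by (simp add: case_prod_beta')
    qed
    then show "?D \<in> borel_measurable P"
      by measurable
  qed
  finally show ?thesis .
qed

text \<open>The bound for one coupling depends neither on the coupling nor on the gauge, so it passes to
both infima. Writing \<open>2 * m + 1\<close> for the factor \<open>2 * m\<close>, with \<open>m\<close> the second moment, keeps the
denominator positive.\<close>

lemma q_GW_ge_of_distortion:
  fixes X :: "'a::euclidean_space set"
  assumes X: "gm_space (top_of_set X, (\<lambda>x x'. x \<bullet> x'), \<xi>)" and n: "n > 0"
    and M: "M = distr \<xi> borel (\<lambda>x. x)" and i: "integrable M (\<lambda>x. (norm x)\<^sup>2)"
    and \<kappa>: "\<kappa> > 0" "\<And>v. \<kappa> * norm v \<le> norm (second_moment_operator M v)"
    and r: "r > 0" "\<And>C. finite C \<Longrightarrow> card C \<le> n \<Longrightarrow> measure M (\<Union>a\<in>C. ball a r) \<le> 1 / 2"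
  shows "\<kappa> * r / sqrt (2 * (\<integral>x. (norm x)\<^sup>2 \<partial>M) + 1)
    \<le> q_GW n (top_of_set X, (\<lambda>x x'. x \<bullet> x'), \<xi>)"
  unfolding q_GW_def
proof (rule cINF_greatest)
  show "GM n \<noteq> {}" by (rule GM_nonempty[OF X n])
  fix \<Y> assume Y: "\<Y> \<in> GM n"
  then obtain G \<upsilon> where Ye: "\<Y> = (discrete_topology {1..n}, G, \<upsilon>)"
    and \<upsilon>: "prob_space \<upsilon>" "sets \<upsilon> = Pow {1..n}"
    by (auto simp: GM_def)
  have gY: "gm_space (discrete_topology {1..n}, G, \<upsilon>)" using GM_gm_space[OF Y] Ye by simp
  have p\<xi>: "prob_space \<xi>" using X by (simp add: gm_space_def)
  define m where "m = (\<integral>x. (norm x)\<^sup>2 \<partial>M)"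
  have "m \<ge> 0" by (simp add: m_def Bochner_Integration.integral_nonneg)
  show "\<kappa> * r / sqrt (2 * (\<integral>x. (norm x)\<^sup>2 \<partial>M) + 1) \<le> GW2 (top_of_set X, (\<lambda>x x'. x \<bullet> x'), \<xi>) \<Y>"
    unfolding Ye GW2_def prod.case m_def[symmetric]
  proof (rule cINF_greatest)
    show "couplings \<xi> \<upsilon> \<noteq> {}" using product_coupling[OF p\<xi> \<upsilon>(1)] by auto
    fix \<pi> assume \<pi>: "\<pi> \<in> couplings \<xi> \<upsilon>"
    then have "prob_space \<pi>" and se[measurable_cong]: "sets \<pi> = sets (\<xi> \<Otimes>\<^sub>M \<upsilon>)"
      and marg: "distr \<pi> \<xi> fst = \<xi>"
      by (auto simp: couplings_def)
    interpret \<pi>: prob_space \<pi> by fact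
    let ?F = "\<lambda>((x, y), (x', y')). \<bar>x \<bullet> x' - G y y'\<bar>\<^sup>2"
    define K where "K = integral\<^sup>L (\<pi> \<Otimes>\<^sub>M \<pi>) ?F"
    have "K \<ge> 0" unfolding K_def by (auto intro!: Bochner_Integration.integral_nonneg)
    have F: "integrable (\<pi> \<Otimes>\<^sub>M \<pi>) ?F" by (rule GW_integrable[OF X gY \<pi>])
    have fst: "fst \<in> \<pi> \<rightarrow>\<^sub>M \<xi>" by measurable
    have "sets \<upsilon> = sets (count_space {1..n})" using \<upsilon>(2) by simp
    from measurable_cong_sets[OF refl this, of \<pi>]
    have snd: "snd \<in> \<pi> \<rightarrow>\<^sub>M count_space {1..n}" by (rule subst) measurable
    note idm = borel_measurable_restricted_identity[OF X]
    have fst_borel: "fst \<in> borel_measurable \<pi>" by (rule measurable_compose[OF fst idm])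
    have "M = distr (distr \<pi> \<xi> fst) borel (\<lambda>x. x)" by (simp add: marg M)
    also have "\<dots> = distr \<pi> borel fst"
      using distr_distr[OF idm fst] by (simp add: comp_def)
    finally have law: "distr \<pi> borel fst = M" ..
    have "ennreal (\<kappa>\<^sup>2 * r\<^sup>2 / 2) \<le> ennreal m *
        (\<integral>\<^sup>+w. \<integral>\<^sup>+w'. ennreal ((fst w \<bullet> fst w' - G (snd w) (snd w'))\<^sup>2) \<partial>\<pi> \<partial>\<pi>)"
      unfolding m_def
      by (rule coupling_distortion_ge[OF \<open>prob_space \<pi>\<close> fst_borel snd law i \<kappa> r])
    also have "(\<integral>\<^sup>+w. \<integral>\<^sup>+w'. ennreal ((fst w \<bullet> fst w' - G (snd w) (snd w'))\<^sup>2) \<partial>\<pi> \<partial>\<pi>)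
        = (\<integral>\<^sup>+z. ennreal (?F z) \<partial>(\<pi> \<Otimes>\<^sub>M \<pi>))"
      using borel_measurable_integrable[OF F]
      by (subst \<pi>.nn_integral_fst[symmetric]) (auto simp: case_prod_beta')
    also have "\<dots> = ennreal K"
      unfolding K_def by (rule nn_integral_eq_integral[OF F]) auto
    finally have "ennreal (\<kappa>\<^sup>2 * r\<^sup>2 / 2) \<le> ennreal (m * K)"
      using \<open>m \<ge> 0\<close> \<open>K \<ge> 0\<close> by (simp add: ennreal_mult)
    then have "\<kappa>\<^sup>2 * r\<^sup>2 / 2 \<le> m * K"
      using \<open>m \<ge> 0\<close> \<open>K \<ge> 0\<close> by simp
    then have "(\<kappa> * r)\<^sup>2 \<le> (2 * m + 1) * K"
      using \<open>K \<ge> 0\<close> by (simp add: power_mult_distrib algebra_simps)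
    then have "\<kappa> * r \<le> sqrt ((2 * m + 1) * K)" by (rule real_le_rsqrt)
    also have "\<dots> = sqrt K * sqrt (2 * m + 1)" by (simp add: real_sqrt_mult)
    finally have "\<kappa> * r / sqrt (2 * m + 1) \<le> sqrt K"
      using \<open>m \<ge> 0\<close> by (simp add: pos_divide_le_eq)
    then show "\<kappa> * r / sqrt (2 * m + 1) \<le> sqrt (integral\<^sup>L (\<pi> \<Otimes>\<^sub>M \<pi>) ?F)"
      unfolding K_def .
  qed
qed

lemma q_GW_lower_bound:
  fixes X :: "'a::euclidean_space set"
  assumes X: "gm_space (top_of_set X, (\<lambda>x x'. x \<bullet> x'), \<xi>)"
    and ac: "absolutely_continuous lborel (distr \<xi> borel (\<lambda>x. x))"
    and i: "integrable \<xi> (\<lambda>x. (norm x)\<^sup>2)"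
  obtains c where "c > 0"
    "\<And>n. n > 0 \<Longrightarrow> c \<le> real n powr (1 / DIM('a)) * q_GW n (top_of_set X, (\<lambda>x x'. x \<bullet> x'), \<xi>)"
proof -
  define M where "M = distr \<xi> borel (\<lambda>x. x)"
  note idm = borel_measurable_restricted_identity[OF X]
  have "prob_space \<xi>" using X by (simp add: gm_space_def)
  then have pM: "prob_space M" unfolding M_def using idm by (rule prob_space.prob_space_distr)
  then have fM: "finite_measure M" by (simp add: prob_space_def)
  have sM: "sets M = sets borel" by (simp add: M_def)
  have acM: "absolutely_continuous lborel M" using ac by (simp add: M_def)
  have iM: "integrable M (\<lambda>x. (norm x)\<^sup>2)"
    unfolding M_def using i by (subst integrable_distr_eq[OF idm]) auto
  obtain \<kappa> where \<kappa>: "\<kappa> > 0" "\<And>v. \<kappa> * norm v \<le> norm (second_moment_operator M v)"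
    using linear_inj_bounded_below_pos[OF linear_second_moment_operator[OF sM iM]
        inj_second_moment_operator[OF pM sM acM iM]] by blast
  obtain a where a: "a > 0"
    "\<And>n C. n > 0 \<Longrightarrow> finite C \<Longrightarrow> card C \<le> n \<Longrightarrow>
       measure M (\<Union>b\<in>C. ball b (a * real n powr (- 1 / DIM('a)))) \<le> 1 / 2"
    using balls_capture_at_most_half[OF fM sM acM] by blast
  define s where "s = sqrt (2 * (\<integral>x. (norm x)\<^sup>2 \<partial>M) + 1)"
  have "(\<integral>x. (norm x)\<^sup>2 \<partial>M) \<ge> 0" by (simp add: Bochner_Integration.integral_nonneg)
  then have "2 * (\<integral>x. (norm x)\<^sup>2 \<partial>M) + 1 > 0" by linarith
  then have "s > 0" by (simp only: s_def real_sqrt_gt_0_iff)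
  show thesis
  proof
    show "\<kappa> * a / s > 0" using \<open>s > 0\<close> \<kappa>(1) a(1) by simp
    fix n :: nat assume n: "n > 0"
    have "\<kappa> * (a * real n powr (- 1 / DIM('a))) / s
        \<le> q_GW n (top_of_set X, (\<lambda>x x'. x \<bullet> x'), \<xi>)"
      unfolding s_def using a n
      by (intro q_GW_ge_of_distortion[OF X n M_def iM \<kappa>]) auto
    then have "real n powr (1 / DIM('a)) * (\<kappa> * (a * real n powr (- 1 / DIM('a))) / s)
        \<le> real n powr (1 / DIM('a)) * q_GW n (top_of_set X, (\<lambda>x x'. x \<bullet> x'), \<xi>)"
      by (intro mult_left_mono) auto
    then show "\<kappa> * a / s \<le> real n powr (1 / DIM('a)) * q_GW n (top_of_set X, (\<lambda>x x'. x \<bullet> x'), \<xi>)"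
      using n by (simp add: powr_minus_divide)
  qed
qed

section \<open>The quantisation rate\<close>

theorem corollary4p6:
  fixes X :: "(real ^ 'd) set" and \<xi> :: "(real ^ 'd) measure" and \<delta> :: real
  assumes "gm_space (top_of_set X, (\<lambda>x x'. x \<bullet> x'), \<xi>)"
    and "absolutely_continuous lborel (distr \<xi> borel (\<lambda>x. x))"
    and "\<delta> > 0"
    and "(\<integral>\<^sup>+ x. ennreal (norm x powr (2 + \<delta>)) \<partial>\<xi>) < \<infinity>"
  shows "limsup (\<lambda>n. ereal (real n powr (1 / real CARD('d))
              * q_GW n (top_of_set X, (\<lambda>x x'. x \<bullet> x'), \<xi>))) < \<infinity> \<and>
         liminf (\<lambda>n. ereal (real n powr (1 / real CARD('d))
              * q_GW n (top_of_set X, (\<lambda>x x'. x \<bullet> x'), \<xi>))) > 0"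
proof
  note idm[measurable] = borel_measurable_restricted_identity[OF assms(1)]
  have "prob_space \<xi>" using assms(1) by (simp add: gm_space_def)
  then interpret prob_space \<xi> .
  have mom: "integrable \<xi> (\<lambda>x. norm x powr (2 + \<delta>))"
    using assms(4) by (intro integrableI_nonneg) auto
  (* The weight has square (1 + norm x) powr (2 + \<delta>), which the moment assumption dominates. *)
  have iw: "integrable \<xi> (\<lambda>x. ((1 + norm x) powr (1 + \<delta> / 2))\<^sup>2)"
  proof (rule Bochner_Integration.integrable_bound)
    show "integrable \<xi> (\<lambda>x. 2 powr (2 + \<delta>) * (1 + norm x powr (2 + \<delta>)))"
      using mom by simp
    have "((1 + t) powr (1 + \<delta> / 2))\<^sup>2 \<le> 2 powr (2 + \<delta>) * (1 + t powr (2 + \<delta>))" if "t \<ge> 0" for t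
    proof -
      have "((1 + t) powr (1 + \<delta> / 2))\<^sup>2 = (1 + t) powr (2 + \<delta>)"
        by (simp add: power2_eq_square flip: powr_add)
      also have "\<dots> \<le> (2 * max 1 t) powr (2 + \<delta>)"
        using that assms(3) by (intro powr_mono2) auto
      also have "\<dots> = 2 powr (2 + \<delta>) * max 1 t powr (2 + \<delta>)"
        using that by (simp add: powr_mult)
      also have "\<dots> \<le> 2 powr (2 + \<delta>) * (1 + t powr (2 + \<delta>))"
        by (intro mult_left_mono) (auto simp: max_def)
      finally show ?thesis .
    qed
    then show "AE x in \<xi>. norm (((1 + norm x) powr (1 + \<delta> / 2))\<^sup>2)
        \<le> norm (2 powr (2 + \<delta>) * (1 + norm x powr (2 + \<delta>)))"
      by (intro AE_I2) simp
  qed measurable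
  have i2: "integrable \<xi> (\<lambda>x. (norm x)\<^sup>2)"
  proof (rule Bochner_Integration.integrable_bound[OF iw])
    have "norm x \<le> (1 + norm x) powr (1 + \<delta> / 2)" for x :: "real ^ 'd"
      using powr_mono[of 1 "1 + \<delta> / 2" "1 + norm x"] assms(3) by simp
    then show "AE x in \<xi>. norm ((norm x)\<^sup>2) \<le> norm (((1 + norm x) powr (1 + \<delta> / 2))\<^sup>2)"
      by (intro AE_I2) (simp add: power_mono)
  qed measurable
  obtain C where C: "\<And>n. n \<ge> 2 ^ CARD('d) \<Longrightarrow>
      real n powr (1 / CARD('d)) * q_GW n (top_of_set X, (\<lambda>x x'. x \<bullet> x'), \<xi>) \<le> C"
    using q_GW_upper_bound[OF assms(1) _ iw] assms(3) by auto
  have "limsup (\<lambda>n. ereal (real n powr (1 / real CARD('d))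
      * q_GW n (top_of_set X, (\<lambda>x x'. x \<bullet> x'), \<xi>))) \<le> ereal C"
    by (rule Limsup_bounded) (auto intro!: C eventually_sequentiallyI)
  then show "limsup (\<lambda>n. ereal (real n powr (1 / real CARD('d))
      * q_GW n (top_of_set X, (\<lambda>x x'. x \<bullet> x'), \<xi>))) < \<infinity>"
    by (rule le_less_trans) simp
  obtain c where c: "c > 0" "\<And>n. n > 0 \<Longrightarrow>
      c \<le> real n powr (1 / CARD('d)) * q_GW n (top_of_set X, (\<lambda>x x'. x \<bullet> x'), \<xi>)"
    using q_GW_lower_bound[OF assms(1,2) i2] by (auto simp: DIM_cart)
  have "ereal c \<le> liminf (\<lambda>n. ereal (real n powr (1 / real CARD('d))
      * q_GW n (top_of_set X, (\<lambda>x x'. x \<bullet> x'), \<xi>)))"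
    by (rule Liminf_bounded) (auto intro!: c eventually_sequentiallyI[of 1])
  then show "liminf (\<lambda>n. ereal (real n powr (1 / real CARD('d))
      * q_GW n (top_of_set X, (\<lambda>x x'. x \<bullet> x'), \<xi>))) > 0"
    using c(1) by (simp add: less_le_trans[of 0 "ereal c"])
qed

end
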